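(* Let $p(x)$ be a real univariate polynomial of degree $n\ge 2$ which is right-Noetherian. Let $x_0$ be the largest real root of $p$, $x_1$ the largest real root of $p'$, and $m$ the multiplicity of $p$ at $x_0$. Then: (i) if $x_0>x_1$, the log-concavity ratio $\alpha_p(x)$ is monotonically increasing on $(x_1,\infty)$ with value from $-\infty$ to $1-\frac1n$ (that is, $\alpha_p(x)\to-\infty$ as $x\to x_1^+$ and $\alpha_p(x)\to 1-\frac1n$ as $x\to\infty$); (ii) if $x_0=x_1$, $\alpha_p(x)$ is monotonically increasing on $[x_0,\infty)$ with value from $1-\frac1m$ to $1-\frac1n$ (that is, $\alpha_p(x_0)=1-\frac1m$ and $\alpha_p(x)\to1-\frac1n$ as $x\to\infty$). In particular, $p$ (or $-p$ if the leading coefficient of $p$ is negative) is logarithmically concave on $(x_0,\infty)$.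
   Context: A real univariate polynomial $p$ of degree $n$ is right-Noetherian if for every $k\in\{0,\dots,n-2\}$ there is a real root of $p^{(k)}$ that is greater than or equal to the largest real root of $p^{(k+1)}$ ($p^{(k)}$ is the $k$-th derivative). For a nonconstant polynomial $p$ the log-concavity ratio is $\alpha_p(x)=\dfrac{p(x)\,p''(x)}{p'(x)^2}$ if $p'(x)\ne0$, and $\alpha_p(x)=\lim_{y\to x}\dfrac{p(y)\,p''(y)}{p'(y)^2}$ (values $\pm\infty$ allowed) if $p'(x)=0$. "Monotonically increasing" is in the non-strict sense ($x<y$ implies $\alpha_p(x)\le\alpha_p(y)$). *)

theory Defs
  imports "HOL-Analysis.Analysis" "HOL-Computational_Algebra.Polynomial"
begin

definition real_roots :: "real poly \<Rightarrow> real set" where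
  "real_roots p = {x. poly p x = 0}"

text \<open>Only meaningful if \<open>p \<noteq> 0\<close> has a real root; otherwise the value is unspecified.\<close>

definition largest_real_root :: "real poly \<Rightarrow> real" where
  "largest_real_root p = Max (real_roots p)"

text \<open>
  Since the derivative of order \<open>degree p - 1\<close> is linear and hence has a real root, the condition
  yields, by downward induction on \<open>k\<close>, a real root of every derivative of order below
  \<open>degree p\<close>. So every \<open>largest_real_root\<close> below is a genuine maximum when the condition holds.
\<close>

definition right_Noetherian :: "real poly \<Rightarrow> bool" where
  "right_Noetherian p \<longleftrightarrow>
     (\<forall>k. k + 2 \<le> degree p \<longrightarrow>
        (\<exists>x \<in> real_roots ((pderiv ^^ k) p). largest_real_root ((pderiv ^^ (k + 1)) p) \<le> x))"

text \<open>
  The limit is taken in the extended reals. It is unspecified where it does not exist, e.g. at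
  \<open>0\<close> for \<open>p = x\<^sup>3 + 1\<close>, where the two one-sided limits are different infinities.
\<close>

definition log_concavity_ratio :: "real poly \<Rightarrow> real \<Rightarrow> ereal" where
  "log_concavity_ratio p x =
     (let r = (\<lambda>y. poly p y * poly (pderiv (pderiv p)) y / (poly (pderiv p) y)\<^sup>2)
      in if poly (pderiv p) x \<noteq> 0 then ereal (r x)
         else Lim (at x) (\<lambda>y. ereal (r y)))"

definition log_concave_on :: "real set \<Rightarrow> (real \<Rightarrow> real) \<Rightarrow> bool" where
  "log_concave_on S f \<longleftrightarrow> (\<forall>x\<in>S. f x > 0) \<and> concave_on S (\<lambda>x. ln (f x))"

end

theory Submission
  imports Defs
begin

text \<open>
  Write \<open>\<alpha>\<close> for the log-concavity ratio of \<open>p\<close> and \<open>\<beta>\<close> for that of \<open>p'\<close>, and let the leading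
  coefficient of \<open>p\<close> be positive. The claim is proved by induction on the degree: if \<open>\<beta>\<close> is
  increasing and at most 1 to the right of the largest root of \<open>p''\<close> (on the whole line when \<open>p'\<close>
  is linear), then \<open>\<alpha>\<close> is increasing and
  at most 1 to the right of the largest root \<open>a\<close> of \<open>p'\<close>.

  On \<open>(a, \<infinity>)\<close> both \<open>p'\<close> and \<open>p''\<close> are positive, and
  \<open>\<alpha>' = (p'' / p') (2 - \<beta>) (\<gamma> - \<alpha>)\<close> with \<open>\<gamma> = 1 / (2 - \<beta>)\<close>. So \<open>\<alpha>\<close> increases exactly where
  \<open>\<alpha> \<le> \<gamma>\<close>. The linear differential equation for \<open>\<alpha> - \<gamma>\<close> has the integrating factor \<open>p'\<^sup>2 / p''\<close>:
  the derivative of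
  \<open>G = (\<alpha> - \<gamma>) p'\<^sup>2 / p'' = p - p'\<^sup>2 p'' / (2 p''\<^sup>2 - p' p''')\<close> equals \<open>- \<gamma>' p'\<^sup>2 / p''\<close>,
  which is nonpositive because \<open>\<beta>\<close>, and with it \<open>\<gamma>\<close>, increases. Thus \<open>G\<close> decreases, and since
  \<open>G \<le> p\<close> it follows that \<open>G x \<le> G y \<le> p y\<close> for \<open>a < y < x\<close>, whence \<open>G x \<le> p a\<close> on
  letting \<open>y\<close> tend to \<open>a\<close>. The right-Noetherian property puts the largest root of \<open>p\<close> at or to the
  right of \<open>a\<close>, so \<open>p a \<le> 0\<close>, and \<open>G \<le> 0\<close> is \<open>\<alpha> \<le> \<gamma>\<close>. Moreover \<open>\<beta> \<le> 1\<close> gives \<open>\<gamma> \<le> 1\<close>,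
  hence \<open>\<alpha> \<le> 1\<close>, which is log-concavity wherever \<open>p\<close> is positive. This is the content of
  \<open>ratio_deriv_numer_step\<close> and \<open>right_Noetherian_ratio\<close>, which treat simple and multiple roots
  alike.

  The limit at infinity is read off from leading coefficients, and the value at a multiple root from
  the factorisation of \<open>p\<close> there. For the limit at \<open>a\<close> when \<open>p a < 0\<close>, the bound \<open>\<beta> \<le> 1\<close> says that
  \<open>p' / p''\<close> increases, so it stays bounded near \<open>a\<close> even if \<open>p''\<close> also vanishes there, and
  \<open>\<alpha> = p (p'' / p') / p'\<close> is below a negative constant divided by \<open>p'\<close>.
\<close>

section \<open>Largest roots of real polynomials\<close>

lemma largest_real_root_root:
  assumes "p \<noteq> 0" "poly p x = 0"
  shows "poly p (largest_real_root p) = 0" "x \<le> largest_real_root p"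
proof -
  have fin: "finite (real_roots p)"
    using poly_roots_finite[OF assms(1)] by (simp add: real_roots_def)
  have x: "x \<in> real_roots p" using assms(2) by (simp add: real_roots_def)
  then have "Max (real_roots p) \<in> real_roots p" using fin Max_in by blast
  then show "poly p (largest_real_root p) = 0"
    by (simp add: largest_real_root_def real_roots_def)
  show "x \<le> largest_real_root p"
    using fin x by (simp add: largest_real_root_def)
qed

lemma poly_pos_beyond_roots:
  fixes p :: "real poly"
  assumes "lead_coeff p > 0" "\<And>y. y \<ge> x \<Longrightarrow> poly p y \<noteq> 0"
  shows "poly p x > 0"
proof (rule ccontr)
  assume "\<not> poly p x > 0"
  with assms(2)[of x] have neg: "poly p x < 0" by auto
  obtain N where N: "\<And>y. y \<ge> N \<Longrightarrow> lead_coeff p \<le> poly p y"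
    using poly_pinfty_gt_lc[OF assms(1)] by blast
  define z where "z = max N (x + 1)"
  have "poly p z > 0" using N[of z] assms(1) by (simp add: z_def)
  moreover have "x < z" by (simp add: z_def)
  ultimately obtain y where "x < y" "poly p y = 0"
    using poly_IVT_pos neg by blast
  with assms(2)[of y] show False by simp
qed

lemma poly_pos_beyond_largest_root:
  assumes "lead_coeff p > 0" "largest_real_root p < x"
  shows "poly p x > 0"
proof (rule poly_pos_beyond_roots[OF assms(1)])
  fix y assume "x \<le> y"
  with assms largest_real_root_root(2)[of p y] show "poly p y \<noteq> 0" by force
qed

lemma lead_coeff_pderiv:
  fixes p :: "real poly"
  assumes "degree p \<ge> 1"
  shows "lead_coeff (pderiv p) = real (degree p) * lead_coeff p"
  using assms by (simp add: degree_pderiv coeff_pderiv del: of_nat_Suc)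

section \<open>Right-Noetherian polynomials\<close>

lemma right_Noetherian_pderiv:
  assumes "right_Noetherian p"
  shows "right_Noetherian (pderiv p)"
  unfolding right_Noetherian_def
proof (intro allI impI)
  fix k assume "k + 2 \<le> degree (pderiv p)"
  then have "Suc k + 2 \<le> degree p" by (simp add: degree_pderiv)
  with assms show "\<exists>x\<in>real_roots ((pderiv ^^ k) (pderiv p)).
      largest_real_root ((pderiv ^^ (k + 1)) (pderiv p)) \<le> x"
    unfolding right_Noetherian_def by (metis Suc_eq_plus1 funpow_Suc_right o_apply)
qed

lemma right_Noetherian_imp_root:
  assumes "right_Noetherian p" "degree p \<ge> 1"
  shows "\<exists>x. poly p x = 0"
proof (cases "degree p = 1")
  case True
  then have "coeff p 1 \<noteq> 0"
    by (metis degree_0 leading_coeff_neq_0 zero_neq_one)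
  with True have "poly p (- coeff p 0 / coeff p 1) = 0"
    by (simp add: poly_altdef)
  then show ?thesis by blast
next
  case False
  with assms(2) have "0 + 2 \<le> degree p" by simp
  with assms(1) show ?thesis
    unfolding right_Noetherian_def real_roots_def by fastforce
qed

lemma right_Noetherian_largest_root_le:
  assumes "right_Noetherian p" "degree p \<ge> 2"
  shows "largest_real_root (pderiv p) \<le> largest_real_root p"
proof -
  have "0 + 2 \<le> degree p" using assms(2) by simp
  then obtain x where "poly p x = 0" "largest_real_root (pderiv p) \<le> x"
    using assms(1) unfolding right_Noetherian_def real_roots_def by fastforce
  moreover have "p \<noteq> 0" using assms(2) by auto
  ultimately show ?thesis using largest_real_root_root(2) by force
qed

lemma right_Noetherian_root:
  assumes "right_Noetherian p" "degree p \<ge> 1"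
  shows "poly p (largest_real_root p) = 0"
proof -
  have "p \<noteq> 0" using assms(2) by auto
  then show ?thesis
    using right_Noetherian_imp_root[OF assms] largest_real_root_root(1) by blast
qed

lemma right_Noetherian_pderiv_root:
  assumes "right_Noetherian p" "degree p \<ge> 2"
  shows "poly (pderiv p) (largest_real_root (pderiv p)) = 0"
  using assms by (intro right_Noetherian_root right_Noetherian_pderiv) (simp_all add: degree_pderiv)

lemma pderiv_pos_right:
  assumes "degree p \<ge> 2" "lead_coeff p > 0" "largest_real_root (pderiv p) < x"
  shows "poly (pderiv p) x > 0"
  using assms by (intro poly_pos_beyond_largest_root) (simp_all add: lead_coeff_pderiv)

text \<open>
  The largest root of \<open>p''\<close> does not exceed that of \<open>p'\<close>, except that \<open>p''\<close> is a positive constant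
  when \<open>p\<close> is quadratic.
\<close>

lemma pderiv_pderiv_pos_right:
  assumes "right_Noetherian p" "degree p \<ge> 2" "lead_coeff p > 0"
    and x: "largest_real_root (pderiv p) < x"
  shows "poly (pderiv (pderiv p)) x > 0"
proof -
  have deg: "degree (pderiv p) \<ge> 1" using assms(2) by (simp add: degree_pderiv)
  have lc: "lead_coeff (pderiv (pderiv p)) > 0"
    using assms(2,3) deg by (subst lead_coeff_pderiv[OF deg]) (simp add: lead_coeff_pderiv)
  show ?thesis
  proof (cases "degree p = 2")
    case True
    then have "degree (pderiv (pderiv p)) = 0" by (simp add: degree_pderiv)
    then obtain c where "pderiv (pderiv p) = [:c:]" by (rule degree_eq_zeroE)
    with lc show ?thesis by simp
  next
    case False
    then have "largest_real_root (pderiv (pderiv p)) \<le> largest_real_root (pderiv p)"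
      using assms by (intro right_Noetherian_largest_root_le right_Noetherian_pderiv)
        (simp_all add: degree_pderiv)
    with x lc show ?thesis by (intro poly_pos_beyond_largest_root) simp_all
  qed
qed

lemma poly_mono_right:
  assumes "degree p \<ge> 2" "lead_coeff p > 0" "largest_real_root (pderiv p) \<le> x" "x < y"
  shows "poly p x < poly p y"
proof (rule DERIV_pos_imp_increasing_open[OF assms(4)])
  fix z assume "x < z" "z < y"
  with assms have "poly (pderiv p) z > 0" by (intro pderiv_pos_right) auto
  then show "\<exists>d. (poly p has_real_derivative d) (at z) \<and> d > 0" using poly_DERIV by blast
qed (intro continuous_intros)

section \<open>Monotonicity of the ratio\<close>

text \<open>
  The derivative of \<open>p p'' / p'\<^sup>2\<close> is this polynomial divided by \<open>p'\<^sup>3\<close>.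
\<close>

definition ratio_deriv_numer :: "real poly \<Rightarrow> real poly" where
  "ratio_deriv_numer p =
     (pderiv p)\<^sup>2 * pderiv (pderiv p) + p * pderiv p * pderiv (pderiv (pderiv p))
       - 2 * p * (pderiv (pderiv p))\<^sup>2"

lemma DERIV_ratio:
  assumes "poly (pderiv p) x \<noteq> 0"
  shows "((\<lambda>y. poly p y * poly (pderiv (pderiv p)) y / (poly (pderiv p) y)\<^sup>2) has_real_derivative
     poly (ratio_deriv_numer p) x / poly (pderiv p) x ^ 3) (at x)"
  using assms
  by (auto intro!: derivative_eq_intros simp: ratio_deriv_numer_def field_simps power2_eq_square
      power3_eq_cube)

text \<open>
  The function \<open>G = p - p'\<^sup>2 p'' / (2 p''\<^sup>2 - p' p''')\<close> from the introductory remarks decreases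
  because its derivative is \<open>- (p' / H)\<^sup>2\<close>, with \<open>H\<close> the denominator, times the polynomial
  \<open>ratio_deriv_numer (pderiv p)\<close>, which is nonnegative as the ratio of \<open>p'\<close> increases.
\<close>

lemma DERIV_gap:
  fixes p :: "real poly"
  defines "H \<equiv> \<lambda>y. 2 * (poly (pderiv (pderiv p)) y)\<^sup>2
                    - poly (pderiv p) y * poly (pderiv (pderiv (pderiv p))) y"
  assumes "H x \<noteq> 0"
  shows "((\<lambda>y. poly p y - (poly (pderiv p) y)\<^sup>2 * poly (pderiv (pderiv p)) y / H y)
     has_real_derivative
     - ((poly (pderiv p) x / H x)\<^sup>2 * poly (ratio_deriv_numer (pderiv p)) x)) (at x)"
proof -
  define b c d e where "b = poly (pderiv p) x" and "c = poly (pderiv (pderiv p)) x"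
    and "d = poly (pderiv (pderiv (pderiv p))) x"
    and "e = poly (pderiv (pderiv (pderiv (pderiv p)))) x"
  have H: "H x = 2 * c\<^sup>2 - b * d" by (simp add: H_def b_def c_def d_def)
  have dH: "(H has_real_derivative (3 * c * d - b * e)) (at x)"
    unfolding H_def b_def c_def d_def e_def
    by (auto intro!: derivative_eq_intros simp: algebra_simps power2_eq_square)
  have "((\<lambda>y. poly p y - (poly (pderiv p) y)\<^sup>2 * poly (pderiv (pderiv p)) y / H y)
     has_real_derivative
     b - ((2 * b * c * c + b\<^sup>2 * d) * H x - b\<^sup>2 * c * (3 * c * d - b * e)) / (H x * H x)) (at x)"
    by (rule derivative_eq_intros dH refl assms(2) | simp add: b_def c_def d_def)+
  moreover have "b - ((2 * b * c * c + b\<^sup>2 * d) * H x - b\<^sup>2 * c * (3 * c * d - b * e)) / (H x * H x)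
     = - ((b / H x)\<^sup>2 * (c\<^sup>2 * d + b * c * e - 2 * b * d\<^sup>2))"
  proof -
    have "b * (H x * H x) - ((2 * b * c * c + b\<^sup>2 * d) * H x - b\<^sup>2 * c * (3 * c * d - b * e))
       = - (b\<^sup>2 * (c\<^sup>2 * d + b * c * e - 2 * b * d\<^sup>2))"
      unfolding H by algebra
    then have "(b * (H x * H x) - ((2 * b * c * c + b\<^sup>2 * d) * H x - b\<^sup>2 * c * (3 * c * d - b * e)))
          / (H x * H x)
       = - (b\<^sup>2 * (c\<^sup>2 * d + b * c * e - 2 * b * d\<^sup>2)) / (H x * H x)"
      by (rule arg_cong)
    then show ?thesis using assms(2) by (simp add: diff_divide_distrib power2_eq_square)
  qed
  moreover have "poly (ratio_deriv_numer (pderiv p)) x = c\<^sup>2 * d + b * c * e - 2 * b * d\<^sup>2"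
    by (simp add: ratio_deriv_numer_def b_def c_def d_def e_def)
  ultimately show ?thesis by (simp add: b_def)
qed

text \<open>
  The inductive step on the degree. Its two conclusions are the two hypotheses on \<open>p'\<close>, restated
  for \<open>p\<close>: the ratio increases, and it is at most 1.
\<close>

lemma ratio_deriv_numer_step:
  fixes p :: "real poly"
  assumes pa: "poly p a \<le> 0"
    and p1: "\<And>y. y > a \<Longrightarrow> poly (pderiv p) y > 0"
    and p2: "\<And>y. y > a \<Longrightarrow> poly (pderiv (pderiv p)) y > 0"
    and F1: "\<And>y. y > a \<Longrightarrow> poly (ratio_deriv_numer (pderiv p)) y \<ge> 0"
    and L1: "\<And>y. y > a \<Longrightarrow> poly (pderiv p) y * poly (pderiv (pderiv (pderiv p))) y
                             \<le> (poly (pderiv (pderiv p)) y)\<^sup>2"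
    and x: "x > a"
  shows "poly (ratio_deriv_numer p) x \<ge> 0"
    and "poly p x * poly (pderiv (pderiv p)) x \<le> (poly (pderiv p) x)\<^sup>2"
proof -
  define H where "H = (\<lambda>y. 2 * (poly (pderiv (pderiv p)) y)\<^sup>2
                    - poly (pderiv p) y * poly (pderiv (pderiv (pderiv p))) y)"
  define G where "G = (\<lambda>y. poly p y - (poly (pderiv p) y)\<^sup>2 * poly (pderiv (pderiv p)) y / H y)"
  define A B C where "A = poly p x" and "B = poly (pderiv p) x" and "C = poly (pderiv (pderiv p)) x"
  have Hlow: "H y \<ge> (poly (pderiv (pderiv p)) y)\<^sup>2" if "y > a" for y
    using L1[OF that] by (simp add: H_def)
  have Hpos: "H y > 0" if "y > a" for y
  proof -
    have "(poly (pderiv (pderiv p)) y)\<^sup>2 > 0" using p2[OF that] by simp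
    with Hlow[OF that] show ?thesis by linarith
  qed
  have Gp: "G x \<le> poly p y" if "a < y" "y < x" for y
  proof -
    have "G x \<le> G y"
    proof (rule DERIV_nonpos_imp_nonincreasing[where f = G])
      fix z assume "y \<le> z" "z \<le> x"
      with that have z: "z > a" by simp
      have "(G has_real_derivative
          - ((poly (pderiv p) z / H z)\<^sup>2 * poly (ratio_deriv_numer (pderiv p)) z)) (at z)"
        using DERIV_gap[of p z] Hpos[OF z] by (simp add: G_def H_def)
      moreover have "- ((poly (pderiv p) z / H z)\<^sup>2 * poly (ratio_deriv_numer (pderiv p)) z) \<le> 0"
        using F1[OF z] by simp
      ultimately show "\<exists>d. (G has_real_derivative d) (at z) \<and> d \<le> 0" by blast
    qed (use that in simp)
    also have "G y \<le> poly p y"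
      using p2[OF that(1)] Hpos[OF that(1)] by (simp add: G_def)
    finally show ?thesis .
  qed
  have "(poly p \<longlongrightarrow> poly p a) (at_right a)"
    by (intro tendsto_intros)
  moreover have "eventually (\<lambda>y. G x \<le> poly p y) (at_right a)"
    using eventually_at_right_less[of a] eventually_at_right_real[OF x]
    by eventually_elim (use Gp in auto)
  ultimately have "G x \<le> poly p a"
    by (intro tendsto_lowerbound) auto
  with pa have "G x \<le> 0" by simp
  then have key: "A * H x \<le> B\<^sup>2 * C"
    using Hpos[OF x] by (simp add: G_def A_def B_def C_def field_simps)
  have "poly (ratio_deriv_numer p) x = B\<^sup>2 * C - A * H x"
    by (simp add: ratio_deriv_numer_def A_def B_def C_def H_def algebra_simps)
  with key show "poly (ratio_deriv_numer p) x \<ge> 0" by simp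
  have C: "C > 0" using p2[OF x] by (simp add: C_def)
  have "A * C \<le> B\<^sup>2"
  proof (cases "A \<ge> 0")
    case True
    then have "A * C\<^sup>2 \<le> A * H x"
      using Hlow[OF x] by (intro mult_left_mono) (simp_all add: C_def)
    with key have "(A * C) * C \<le> B\<^sup>2 * C" by (simp add: power2_eq_square mult.assoc)
    with C show ?thesis by simp
  next
    case False
    then have "A * C \<le> 0" using C by (simp add: mult_nonpos_nonneg)
    then show ?thesis using zero_le_power2[of B] by linarith
  qed
  then show "poly p x * poly (pderiv (pderiv p)) x \<le> (poly (pderiv p) x)\<^sup>2"
    by (simp add: A_def B_def C_def)
qed

text \<open>
  Degree 1 starts the induction: there \<open>p'' = 0\<close>, and the bounds hold on the whole line. This is why
  the restriction on \<open>x\<close> applies from degree 2 on only.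
\<close>

lemma right_Noetherian_ratio:
  assumes "right_Noetherian p" "degree p \<ge> 1" "lead_coeff p > 0"
    and "degree p \<ge> 2 \<Longrightarrow> largest_real_root (pderiv p) < x"
  shows "poly (ratio_deriv_numer p) x \<ge> 0 \<and>
         poly p x * poly (pderiv (pderiv p)) x \<le> (poly (pderiv p) x)\<^sup>2"
  using assms
proof (induction "degree p" arbitrary: p x)
  case 0
  then show ?case by simp
next
  case (Suc d)
  show ?case
  proof (cases "d = 0")
    case True
    with Suc.hyps(2) have "degree (pderiv p) = 0" by (simp add: degree_pderiv)
    then have "pderiv (pderiv p) = 0" by (simp add: pderiv_eq_0_iff)
    then show ?thesis by (simp add: ratio_deriv_numer_def)
  next
    case False
    define a where "a = largest_real_root (pderiv p)"
    have deg: "degree p \<ge> 2" using False Suc.hyps(2) by simp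
    have "poly p (largest_real_root p) = 0"
      using Suc.prems by (intro right_Noetherian_root)
    then have pa: "poly p a \<le> 0"
      using right_Noetherian_largest_root_le[OF Suc.prems(1) deg]
        poly_mono_right[OF deg Suc.prems(3), of a "largest_real_root p"]
      by (cases "a = largest_real_root p") (auto simp: a_def)
    have IH: "poly (ratio_deriv_numer (pderiv p)) y \<ge> 0 \<and>
        poly (pderiv p) y * poly (pderiv (pderiv (pderiv p))) y \<le> (poly (pderiv (pderiv p)) y)\<^sup>2"
      if "y > a" for y
    proof (rule Suc.hyps(1))
      show "d = degree (pderiv p)" "1 \<le> degree (pderiv p)"
        using Suc.hyps(2) deg by (simp_all add: degree_pderiv)
      show RN: "right_Noetherian (pderiv p)"
        using Suc.prems(1) by (rule right_Noetherian_pderiv)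
      show "lead_coeff (pderiv p) > 0"
        using deg Suc.prems(3) by (simp add: lead_coeff_pderiv)
      show "largest_real_root (pderiv (pderiv p)) < y" if "2 \<le> degree (pderiv p)"
        using right_Noetherian_largest_root_le[OF RN that] \<open>y > a\<close> by (simp add: a_def)
    qed
    have x: "x > a" using Suc.prems(4) deg by (simp add: a_def)
    show ?thesis
      using ratio_deriv_numer_step[OF pa _ _ _ _ x]
        pderiv_pos_right[OF deg Suc.prems(3)]
        pderiv_pderiv_pos_right[OF Suc.prems(1) deg Suc.prems(3)] IH
      by (auto simp: a_def)
  qed
qed

lemma log_concavity_ratio_eq:
  assumes "poly (pderiv p) x \<noteq> 0"
  shows "log_concavity_ratio p x =
    ereal (poly p x * poly (pderiv (pderiv p)) x / (poly (pderiv p) x)\<^sup>2)"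
  using assms by (simp add: log_concavity_ratio_def)

lemma mono_on_log_concavity_ratio:
  assumes RN: "right_Noetherian p" and deg: "degree p \<ge> 2" and lc: "lead_coeff p > 0"
  shows "mono_on {largest_real_root (pderiv p)<..} (log_concavity_ratio p)"
proof (rule mono_onI)
  let ?r = "\<lambda>y. poly p y * poly (pderiv (pderiv p)) y / (poly (pderiv p) y)\<^sup>2"
  fix x y
  assume xy: "x \<in> {largest_real_root (pderiv p)<..}" "y \<in> {largest_real_root (pderiv p)<..}"
    "x \<le> y"
  note pos = pderiv_pos_right[OF deg lc]
  have "?r x \<le> ?r y"
  proof (rule DERIV_nonneg_imp_nondecreasing[OF xy(3)])
    fix z assume "x \<le> z" "z \<le> y"
    with xy have z: "largest_real_root (pderiv p) < z" by simp
    have "poly (ratio_deriv_numer p) z \<ge> 0"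
      using right_Noetherian_ratio[OF RN _ lc, of z] deg z by simp
    then have "poly (ratio_deriv_numer p) z / poly (pderiv p) z ^ 3 \<ge> 0"
      using pos[OF z] by simp
    with DERIV_ratio[of p z] pos[OF z]
    show "\<exists>d. (?r has_real_derivative d) (at z) \<and> 0 \<le> d" by fastforce
  qed
  moreover have "poly (pderiv p) x \<noteq> 0" "poly (pderiv p) y \<noteq> 0"
    using xy pos[of x] pos[of y] by simp_all
  ultimately show "log_concavity_ratio p x \<le> log_concavity_ratio p y"
    by (simp add: log_concavity_ratio_eq)
qed

section \<open>Boundary behaviour of the ratio\<close>

lemma log_concavity_ratio_at_top:
  fixes p :: "real poly"
  assumes deg: "degree p \<ge> 2"
  shows "(log_concavity_ratio p \<longlongrightarrow> ereal (1 - 1 / real (degree p))) at_top"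
proof -
  define n c where "n = degree p" and "c = lead_coeff p"
  have n: "n \<ge> 2" and c: "c \<noteq> 0" using deg by (auto simp: n_def c_def)
  have d1: "degree (pderiv p) = n - 1" and d2: "degree (pderiv (pderiv p)) = n - 2"
    by (simp_all add: degree_pderiv n_def)
  have c1: "lead_coeff (pderiv p) = real n * c"
    using deg by (simp add: lead_coeff_pderiv n_def c_def)
  have c2: "lead_coeff (pderiv (pderiv p)) = real (n - 1) * (real n * c)"
  proof -
    have "1 \<le> degree (pderiv p)" using n by (simp add: d1)
    from lead_coeff_pderiv[OF this] show ?thesis unfolding c1 unfolding d1 .
  qed
  have lim: "((\<lambda>x. poly q x / x ^ degree q) \<longlongrightarrow> lead_coeff q) at_top" for q :: "real poly"
    using poly_divide_tendsto_aux at_top_le_at_infinity tendsto_mono by blast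
  have l0: "((\<lambda>x. poly p x / x ^ n) \<longlongrightarrow> c) at_top"
    using lim[of p] by (simp add: n_def c_def)
  have l1: "((\<lambda>x. poly (pderiv p) x / x ^ (n - 1)) \<longlongrightarrow> real n * c) at_top"
    using lim[of "pderiv p"] unfolding c1 unfolding d1 .
  have l2: "((\<lambda>x. poly (pderiv (pderiv p)) x / x ^ (n - 2))
      \<longlongrightarrow> real (n - 1) * (real n * c)) at_top"
    using lim[of "pderiv (pderiv p)"] unfolding c2 unfolding d2 .
  have "((\<lambda>x. (poly p x / x ^ n) * (poly (pderiv (pderiv p)) x / x ^ (n - 2))
            / (poly (pderiv p) x / x ^ (n - 1))\<^sup>2)
      \<longlongrightarrow> c * (real (n - 1) * (real n * c)) / (real n * c)\<^sup>2) at_top"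
    using n c by (intro tendsto_intros l0 l1 l2) simp
  also have "c * (real (n - 1) * (real n * c)) / (real n * c)\<^sup>2 = 1 - 1 / real n"
    using n c by (simp add: of_nat_diff field_simps power2_eq_square)
  finally have "((\<lambda>x. (poly p x / x ^ n) * (poly (pderiv (pderiv p)) x / x ^ (n - 2))
            / (poly (pderiv p) x / x ^ (n - 1))\<^sup>2) \<longlongrightarrow> 1 - 1 / real n) at_top" .
  then have L: "((\<lambda>x. ereal ((poly p x / x ^ n) * (poly (pderiv (pderiv p)) x / x ^ (n - 2))
            / (poly (pderiv p) x / x ^ (n - 1))\<^sup>2)) \<longlongrightarrow> ereal (1 - 1 / real n)) at_top"
    by (rule tendsto_ereal)
  have nz: "pderiv p \<noteq> 0" using c1 n c by auto
  have "eventually (\<lambda>x. poly (pderiv p) x \<noteq> 0) at_top"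
    using eventually_gt_at_top[of "largest_real_root (pderiv p)"]
    by eventually_elim (use largest_real_root_root(2)[OF nz] in force)
  then have "eventually (\<lambda>x. ereal ((poly p x / x ^ n) * (poly (pderiv (pderiv p)) x / x ^ (n - 2))
            / (poly (pderiv p) x / x ^ (n - 1))\<^sup>2) = log_concavity_ratio p x) at_top"
    using eventually_gt_at_top[of 0]
  proof eventually_elim
    case (elim x)
    obtain k where k: "n = k + 2" using n by (metis add.commute le_Suc_ex)
    have "(poly p x / x ^ n) * (poly (pderiv (pderiv p)) x / x ^ (n - 2))
            / (poly (pderiv p) x / x ^ (n - 1))\<^sup>2
        = poly p x * poly (pderiv (pderiv p)) x / (poly (pderiv p) x)\<^sup>2"
      using elim by (simp add: k field_simps power2_eq_square)
    then show ?case using elim by (simp add: log_concavity_ratio_eq)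
  qed
  from Lim_transform_eventually[OF L this] show ?thesis by (simp add: n_def)
qed

text \<open>
  Boundedness of \<open>p' / p''\<close> near the root \<open>a\<close> of \<open>p'\<close> replaces a comparison of multiplicities.
\<close>

lemma log_concavity_ratio_at_right:
  fixes p :: "real poly"
  defines "a \<equiv> largest_real_root (pderiv p)"
  assumes RN: "right_Noetherian p" and deg: "degree p \<ge> 2" and lc: "lead_coeff p > 0"
    and less: "a < largest_real_root p"
  shows "(log_concavity_ratio p \<longlongrightarrow> -\<infinity>) (at_right a)"
proof -
  define b where "b = largest_real_root p"
  define C where "C = poly (pderiv p) b / poly (pderiv (pderiv p)) b"
  have ab: "a < b" using less by (simp add: b_def)
  have p1: "poly (pderiv p) y > 0" if "y > a" for y
    using pderiv_pos_right[OF deg lc] that by (simp add: a_def)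
  have p2: "poly (pderiv (pderiv p)) y > 0" if "y > a" for y
    using pderiv_pderiv_pos_right[OF RN deg lc] that by (simp add: a_def)
  have p1a: "poly (pderiv p) a = 0"
    unfolding a_def by (rule right_Noetherian_pderiv_root[OF RN deg])
  have pb: "poly p b = 0" unfolding b_def using RN deg by (intro right_Noetherian_root) auto
  have neg: "poly p y < 0" if "a \<le> y" "y < b" for y
    using poly_mono_right[OF deg lc, of y b] that pb by (simp add: a_def)
  have Cpos: "C > 0" using p1[OF ab] p2[OF ab] by (simp add: C_def)
  have L1: "poly (pderiv p) y * poly (pderiv (pderiv (pderiv p))) y
              \<le> (poly (pderiv (pderiv p)) y)\<^sup>2" if y: "y > a" for y
  proof -
    have RN1: "right_Noetherian (pderiv p)" using RN by (rule right_Noetherian_pderiv)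
    have "largest_real_root (pderiv (pderiv p)) < y" if "degree (pderiv p) \<ge> 2"
      using right_Noetherian_largest_root_le[OF RN1 that] y by (simp add: a_def)
    moreover have "degree (pderiv p) \<ge> 1" "lead_coeff (pderiv p) > 0"
      using deg lc by (simp add: degree_pderiv, simp add: lead_coeff_pderiv)
    ultimately show ?thesis
      using right_Noetherian_ratio[OF RN1, of y] by blast
  qed
  have quot: "poly (pderiv p) y / poly (pderiv (pderiv p)) y \<le> C" if y: "a < y" "y < b" for y
    unfolding C_def
  proof (rule DERIV_nonneg_imp_nondecreasing
      [where f = "\<lambda>y. poly (pderiv p) y / poly (pderiv (pderiv p)) y"])
    fix z assume "y \<le> z" "z \<le> b"
    with y have z: "z > a" by simp
    have "((\<lambda>y. poly (pderiv p) y / poly (pderiv (pderiv p)) y) has_real_derivative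
        ((poly (pderiv (pderiv p)) z)\<^sup>2 - poly (pderiv p) z * poly (pderiv (pderiv (pderiv p))) z)
          / (poly (pderiv (pderiv p)) z)\<^sup>2) (at z)"
      using p2[OF z] by (auto intro!: derivative_eq_intros simp: power2_eq_square)
    moreover have "((poly (pderiv (pderiv p)) z)\<^sup>2
        - poly (pderiv p) z * poly (pderiv (pderiv (pderiv p))) z)
          / (poly (pderiv (pderiv p)) z)\<^sup>2 \<ge> 0"
      using L1[OF z] by simp
    ultimately show "\<exists>d. ((\<lambda>y. poly (pderiv p) y / poly (pderiv (pderiv p)) y)
        has_real_derivative d) (at z) \<and> 0 \<le> d" by blast
  qed (use y in simp)
  have ev: "eventually (\<lambda>y. a < y \<and> y < b) (at_right a)"
    using eventually_at_right_real[OF ab] by simp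
  have "((\<lambda>y. C * poly (pderiv p) y) \<longlongrightarrow> C * poly (pderiv p) a) (at_right a)"
    by (intro tendsto_intros)
  then have "((\<lambda>y. C * poly (pderiv p) y) \<longlongrightarrow> 0) (at_right a)" using p1a by simp
  moreover have "eventually (\<lambda>y. C * poly (pderiv p) y > 0) (at_right a)"
    using ev by eventually_elim (use p1 Cpos in simp)
  ultimately have inv: "filterlim (\<lambda>y. inverse (C * poly (pderiv p) y)) at_top (at_right a)"
    by (rule filterlim_inverse_at_top)
  have "(poly p \<longlongrightarrow> poly p a) (at_right a)" by (intro tendsto_intros)
  then have bot: "filterlim (\<lambda>y. poly p y * inverse (C * poly (pderiv p) y)) at_bot (at_right a)"
    using neg[of a] ab inv by (intro filterlim_tendsto_neg_mult_at_bot) auto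
  have "filterlim (\<lambda>y. poly p y * poly (pderiv (pderiv p)) y / (poly (pderiv p) y)\<^sup>2)
      at_bot (at_right a)"
  proof (rule filterlim_at_bot_mono[OF bot])
    show "eventually (\<lambda>y. poly p y * poly (pderiv (pderiv p)) y / (poly (pderiv p) y)\<^sup>2
        \<le> poly p y * inverse (C * poly (pderiv p) y)) (at_right a)"
      using ev
    proof eventually_elim
      case (elim y)
      have "poly (pderiv p) y \<le> C * poly (pderiv (pderiv p)) y"
        using quot[of y] p2[of y] elim by (simp add: field_simps)
      then have "inverse (C * poly (pderiv p) y)
          \<le> poly (pderiv (pderiv p)) y / (poly (pderiv p) y)\<^sup>2"
        using p1[of y] Cpos elim by (simp add: field_simps power2_eq_square)
      then have "poly p y * (poly (pderiv (pderiv p)) y / (poly (pderiv p) y)\<^sup>2)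
          \<le> poly p y * inverse (C * poly (pderiv p) y)"
        using neg[of y] elim by (intro mult_left_mono_neg) auto
      then show ?case by simp
    qed
  qed
  then have L: "((\<lambda>y. ereal (poly p y * poly (pderiv (pderiv p)) y / (poly (pderiv p) y)\<^sup>2))
      \<longlongrightarrow> -\<infinity>) (at_right a)"
    by (simp add: tendsto_MInfty filterlim_at_bot_dense)
  have "eventually (\<lambda>y. ereal (poly p y * poly (pderiv (pderiv p)) y / (poly (pderiv p) y)\<^sup>2)
      = log_concavity_ratio p y) (at_right a)"
    using ev
  proof eventually_elim
    case (elim y)
    then have "poly (pderiv p) y \<noteq> 0" using p1[of y] by simp
    then show ?case by (simp add: log_concavity_ratio_eq)
  qed
  from Lim_transform_eventually[OF L this] show ?thesis .
qed

lemma pderiv_linear_power_mult: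
  fixes q :: "real poly"
  shows "pderiv ([:- a, 1:] ^ Suc k * q)
    = [:- a, 1:] ^ k * (smult (real (Suc k)) q + [:- a, 1:] * pderiv q)"
  by (simp add: pderiv_mult pderiv_power_Suc pderiv_pCons algebra_simps del: of_nat_Suc power_Suc)
     (simp add: algebra_simps)

text \<open>
  At a root of multiplicity \<open>m \<ge> 2\<close>, factoring \<open>p = (x - a)\<^sup>m q\<close> leaves the common power
  \<open>2 m - 2\<close> of \<open>x - a\<close> in numerator and denominator, and the remaining factors take the values
  \<open>m (m - 1) q(a)\<^sup>2\<close> and \<open>m\<^sup>2 q(a)\<^sup>2\<close> at \<open>a\<close>.
\<close>

lemma log_concavity_ratio_tendsto_root:
  fixes p :: "real poly"
  assumes "p \<noteq> 0" and m: "order a p \<ge> 2"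
  shows "((\<lambda>y. ereal (poly p y * poly (pderiv (pderiv p)) y / (poly (pderiv p) y)\<^sup>2))
    \<longlongrightarrow> ereal (1 - 1 / real (order a p))) (at a)"
proof -
  obtain k where k: "order a p = Suc (Suc k)"
    using m by (metis Suc_le_D add_2_eq_Suc le_Suc_ex)
  define u where "u = [:- a, 1:]"
  obtain q where p: "p = u ^ Suc (Suc k) * q" and q: "\<not> u dvd q"
    using order_decomp[OF assms(1), of a] by (auto simp: k u_def)
  define r where "r = smult (real (Suc (Suc k))) q + u * pderiv q"
  define s where "s = smult (real (Suc k)) r + u * pderiv r"
  have p1: "pderiv p = u ^ Suc k * r"
    unfolding p r_def u_def by (rule pderiv_linear_power_mult)
  have p2: "pderiv (pderiv p) = u ^ k * s"
    unfolding p1 s_def u_def by (rule pderiv_linear_power_mult)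
  have qa: "poly q a \<noteq> 0" using q by (simp add: u_def poly_eq_0_iff_dvd)
  have ra: "poly r a = real (Suc (Suc k)) * poly q a" by (simp add: r_def u_def)
  have sa: "poly s a = real (Suc k) * poly r a" by (simp add: s_def u_def)
  have ra0: "poly r a \<noteq> 0" using qa by (simp add: ra del: of_nat_Suc)
  have "((\<lambda>y. poly q y * poly s y / (poly r y)\<^sup>2) \<longlongrightarrow> poly q a * poly s a / (poly r a)\<^sup>2) (at a)"
    using ra0 by (intro tendsto_intros) simp_all
  also have "poly q a * poly s a / (poly r a)\<^sup>2 = real (Suc k) / real (Suc (Suc k))"
    using qa by (simp add: sa ra power2_eq_square del: of_nat_Suc)
  also have "\<dots> = 1 - 1 / real (order a p)"
    by (simp add: k field_simps)
  finally have L: "((\<lambda>y. poly q y * poly s y / (poly r y)\<^sup>2)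
      \<longlongrightarrow> 1 - 1 / real (order a p)) (at a)" .
  have "eventually (\<lambda>y. y \<noteq> a) (at a)" by (simp add: eventually_at_filter)
  then have "eventually (\<lambda>y. poly q y * poly s y / (poly r y)\<^sup>2
      = poly p y * poly (pderiv (pderiv p)) y / (poly (pderiv p) y)\<^sup>2) (at a)"
  proof eventually_elim
    case (elim y)
    define t where "t = y - a"
    have t: "t \<noteq> 0" using elim by (simp add: t_def)
    have u: "poly u y = t" by (simp add: u_def t_def)
    have "poly p y = t ^ Suc (Suc k) * poly q y" by (simp add: p u)
    moreover have "poly (pderiv p) y = t ^ Suc k * poly r y" by (simp add: p1 u)
    moreover have "poly (pderiv (pderiv p)) y = t ^ k * poly s y" by (simp add: p2 u)
    ultimately have "poly p y * poly (pderiv (pderiv p)) y / (poly (pderiv p) y)\<^sup>2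
      = ((t ^ Suc k)\<^sup>2 * (poly q y * poly s y)) / ((t ^ Suc k)\<^sup>2 * (poly r y)\<^sup>2)"
      by (simp add: power2_eq_square mult_ac)
    with t show ?case by simp
  qed
  from Lim_transform_eventually[OF L this] show ?thesis by (rule tendsto_ereal)
qed

section \<open>Log-concavity and the sign of the leading coefficient\<close>

lemma log_concave_on_right:
  assumes RN: "right_Noetherian p" and deg: "degree p \<ge> 2" and lc: "lead_coeff p > 0"
  shows "log_concave_on {largest_real_root p<..} (poly p)"
  unfolding log_concave_on_def
proof
  show pos: "\<forall>x\<in>{largest_real_root p<..}. poly p x > 0"
    using poly_pos_beyond_largest_root[OF lc] by simp
  show "concave_on {largest_real_root p<..} (\<lambda>x. ln (poly p x))"
  proof (rule f''_le0_imp_concave)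
    fix x assume "x \<in> {largest_real_root p<..}"
    then have x: "poly p x > 0" "largest_real_root (pderiv p) < x"
      using pos right_Noetherian_largest_root_le[OF RN deg] by auto
    show "((\<lambda>x. ln (poly p x)) has_real_derivative poly (pderiv p) x / poly p x) (at x)"
      using x by (auto intro!: derivative_eq_intros)
    show "((\<lambda>x. poly (pderiv p) x / poly p x) has_real_derivative
        (poly p x * poly (pderiv (pderiv p)) x - (poly (pderiv p) x)\<^sup>2) / (poly p x)\<^sup>2) (at x)"
      using x by (auto intro!: derivative_eq_intros simp: power2_eq_square)
    show "(poly p x * poly (pderiv (pderiv p)) x - (poly (pderiv p) x)\<^sup>2) / (poly p x)\<^sup>2 \<le> 0"
      using right_Noetherian_ratio[OF RN _ lc, of x] deg x by (simp add: divide_nonpos_nonneg)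
  qed simp
qed

lemma real_roots_uminus [simp]: "real_roots (- p) = real_roots p"
  by (simp add: real_roots_def)

lemma largest_real_root_uminus [simp]: "largest_real_root (- p) = largest_real_root p"
  by (simp add: largest_real_root_def)

lemma funpow_pderiv_uminus: "(pderiv ^^ k) (- p) = - (pderiv ^^ k) (p :: real poly)"
  by (induction k) (simp_all add: pderiv_minus)

lemma right_Noetherian_uminus [simp]: "right_Noetherian (- p) = right_Noetherian p"
  unfolding right_Noetherian_def funpow_pderiv_uminus by simp

lemma log_concavity_ratio_uminus [simp]: "log_concavity_ratio (- p) = log_concavity_ratio p"
  by (rule ext) (simp add: log_concavity_ratio_def pderiv_minus)

section \<open>Monotonicity and log-concavity for right-Noetherian polynomials\<close>

theorem theorem1p4:
  fixes p :: "real poly" and n m :: nat and x0 x1 :: real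
  assumes "degree p = n" and "n \<ge> 2"
    and "right_Noetherian p"
    and "x0 = largest_real_root p"
    and "x1 = largest_real_root (pderiv p)"
    and "m = order x0 p"
  shows "(x0 > x1 \<longrightarrow>
            mono_on {x1<..} (log_concavity_ratio p) \<and>
            (log_concavity_ratio p \<longlongrightarrow> -\<infinity>) (at_right x1) \<and>
            (log_concavity_ratio p \<longlongrightarrow> ereal (1 - 1 / real n)) at_top) \<and>
         (x0 = x1 \<longrightarrow>
            mono_on {x0..} (log_concavity_ratio p) \<and>
            log_concavity_ratio p x0 = ereal (1 - 1 / real m) \<and>
            (log_concavity_ratio p \<longlongrightarrow> ereal (1 - 1 / real n)) at_top) \<and>
         log_concave_on {x0<..} (poly (if lead_coeff p < 0 then - p else p))"
proof -
  define P where "P = (if lead_coeff p < 0 then - p else p)"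
  have deg: "degree P \<ge> 2" and degn: "degree P = n"
    using assms(1,2) by (auto simp: P_def)
  have "p \<noteq> 0" using assms(1,2) by auto
  then have "lead_coeff p < 0 \<or> lead_coeff p > 0"
    by (metis leading_coeff_neq_0 linorder_neqE)
  then have lc: "lead_coeff P > 0" by (auto simp: P_def)
  then have P0: "P \<noteq> 0" by auto
  have RN: "right_Noetherian P" using assms(3) by (simp add: P_def)
  have x0: "x0 = largest_real_root P" and x1: "x1 = largest_real_root (pderiv P)"
    using assms(4,5) by (simp_all add: P_def pderiv_minus)
  have m: "m = order x0 P" using assms(6) by (simp add: P_def order_uminus)
  have ratio: "log_concavity_ratio p = log_concavity_ratio P" by (simp add: P_def)
  note mono = mono_on_log_concavity_ratio[OF RN deg lc, folded x1]
  have top: "(log_concavity_ratio P \<longlongrightarrow> ereal (1 - 1 / real n)) at_top"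
    using log_concavity_ratio_at_top[OF deg] by (simp add: degn)
  have right: "(log_concavity_ratio P \<longlongrightarrow> -\<infinity>) (at_right x1)" if "x0 > x1"
    using log_concavity_ratio_at_right[OF RN deg lc] that by (simp add: x0 x1)
  have multiple: "mono_on {x0..} (log_concavity_ratio P) \<and>
      log_concavity_ratio P x0 = ereal (1 - 1 / real m)" if eq: "x0 = x1"
  proof -
    have p1: "poly (pderiv P) x0 = 0"
      using right_Noetherian_pderiv_root[OF RN deg] by (simp add: eq x1)
    have "poly P x0 = 0" unfolding x0 using RN deg by (intro right_Noetherian_root) auto
    moreover have "pderiv P \<noteq> 0" using deg by (auto simp: pderiv_eq_0_iff)
    ultimately have "order x0 P = Suc (order x0 (pderiv P))" "order x0 (pderiv P) \<noteq> 0"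
      using P0 p1 by (auto simp: order_root intro: order_pderiv)
    then have "order x0 P \<ge> 2" by simp
    then have lim: "((\<lambda>y. ereal (poly P y * poly (pderiv (pderiv P)) y / (poly (pderiv P) y)\<^sup>2))
        \<longlongrightarrow> ereal (1 - 1 / real m)) (at x0)"
      using log_concavity_ratio_tendsto_root[OF P0] by (simp add: m)
    then have val: "log_concavity_ratio P x0 = ereal (1 - 1 / real m)"
      using p1 by (simp add: log_concavity_ratio_def tendsto_Lim)
    have "eventually (\<lambda>y. ereal (poly P y * poly (pderiv (pderiv P)) y / (poly (pderiv P) y)\<^sup>2)
        = log_concavity_ratio P y) (at_right x0)"
      using eventually_at_right_less[of x0]
    proof eventually_elim
      case (elim y)
      then have "poly (pderiv P) y \<noteq> 0"
        using pderiv_pos_right[OF deg lc, of y] by (simp add: eq x1)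
      then show ?case by (simp add: log_concavity_ratio_eq)
    qed
    \<comment> \<open>The value at \<open>x0\<close> is also the limit from the right, so monotonicity extends to the endpoint.\<close>
    with lim have right_lim: "(log_concavity_ratio P \<longlongrightarrow> ereal (1 - 1 / real m)) (at_right x0)"
      using Lim_transform_eventually filterlim_at_split by blast
    have start: "log_concavity_ratio P x0 \<le> log_concavity_ratio P y" if "x0 < y" for y
      unfolding val
    proof (rule tendsto_upperbound[OF right_lim])
      show "eventually (\<lambda>z. log_concavity_ratio P z \<le> log_concavity_ratio P y) (at_right x0)"
        using eventually_at_right_real[OF that]
        by eventually_elim (use mono that eq in \<open>auto intro: mono_onD\<close>)
    qed simp
    have "mono_on {x0..} (log_concavity_ratio P)"
    proof (rule mono_onI)
      fix x y assume xy: "x \<in> {x0..}" "y \<in> {x0..}" "x \<le> y"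
      show "log_concavity_ratio P x \<le> log_concavity_ratio P y"
      proof (cases "x = x0")
        case True
        with start[of y] xy show ?thesis by (cases "y = x0") auto
      next
        case False
        with xy eq show ?thesis by (intro mono_onD[OF mono]) auto
      qed
    qed
    with val show ?thesis by simp
  qed
  have "log_concave_on {x0<..} (poly P)"
    unfolding x0 by (rule log_concave_on_right[OF RN deg lc])
  with mono top right multiple show ?thesis
    unfolding ratio P_def[symmetric] by blast
qed

end
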